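(* Let $(\mathbf{W},\mathbf{w})$ and $(\mathbf{V},\mathbf{v})$ be Bessel fusion sequences for $\mathcal{H}$ (both indexed by $\{1,\ldots,m\}$), and for $i=1,\ldots,m$ let $\mathcal{F}_i$ be a frame for $W_i$ and $\mathcal{G}_i$ a frame for $V_i$ with $|\mathcal{F}_i|=|\mathcal{G}_i|$. The following conditions are equivalent: (1) $\mathbf{w}\mathcal{F}$ and $\mathbf{v}\mathcal{G}$ are dual frames for $\mathcal{H}$. (2) $(\mathbf{V},\mathbf{v},\mathcal{G})$ is a dual fusion frame system of $(\mathbf{W},\mathbf{w},\mathcal{F})$.
   Context: $\mathcal{H}$ is a finite-dimensional Hilbert space over $\mathbb{F}=\mathbb{R}$ or $\mathbb{C}$, $m\in\mathbb{N}$. Frames: a finite family $\{f_l\}_{l\in L}$ in a finite-dimensional Hilbert space $\mathcal{K}$ is a frame for $\mathcal{K}$ if it spans $\mathcal{K}$; its synthesis operator is $T(x_l)_{l\in L}=\sum_l x_lf_l$ on $\mathbb{F}^{|L|}$, with adjoint (analysis operator) $T^*f=(\langle f,f_l\rangle)_l$. Frames $\{f_l\}_{l\in L}$ and $\{\tilde f_l\}_{l\in L}$ for $\mathcal{K}$ are dual frames if $f=\sum_l\langle f,f_l\rangle\tilde f_l$ for all $f\in\mathcal{K}$. Fusion frames: a Bessel fusion sequence $(\mathbf{W},\mathbf{w})=\{(W_i,w_i)\}_{i=1}^m$ is a family of subspaces $W_i$ of $\mathcal{H}$ with weights $w_i>0$. Put $\mathcal{W}=\bigoplus_{i=1}^m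 W_i$ (external direct sum, with inner product $\sum_i\langle f_i,g_i\rangle$); similarly $\mathcal{V}=\bigoplus_i V_i$. Let $T_{\mathbf{W},\mathbf{w}}:\mathcal{W}\to\mathcal{H}$, $T_{\mathbf{W},\mathbf{w}}(f_i)_i=\sum_i w_if_i$, with adjoint $T^*_{\mathbf{W},\mathbf{w}}f=(w_i\pi_{W_i}f)_i$, $\pi_{W_i}$ the orthogonal projection onto $W_i$. $(\mathbf{W},\mathbf{w})$ is a fusion frame for $\mathcal{H}$ if $\mathrm{span}\bigcup_iW_i=\mathcal{H}$. If $(\mathbf{W},\mathbf{w})$, $(\mathbf{V},\mathbf{v})$ are fusion frames for $\mathcal{H}$ and $Q:\mathcal{W}\to\mathcal{V}$ is linear, $(\mathbf{V},\mathbf{v})$ is a $Q$-dual fusion frame of $(\mathbf{W},\mathbf{w})$ if $T_{\mathbf{V},\mathbf{v}}QT^*_{\mathbf{W},\mathbf{w}}=I_{\mathcal{H}}$. Fusion frame systems: write $\mathcal{F}_i=\{f_i^l\}_{l\in L_i}$, $\mathcal{F}=\{\mathcal{F}_i\}_{i=1}^m$, and $\mathbf{w}\mathcal{F}=\{w_if_i^l\}_{l\in L_i,\,i=1,\ldots,m}$; similarly $\mathcal{G}_i=\{g_i^l\}_{l\in L_i}$ (same index sets) and $\mathbf{v}\mathcal{G}=\{v_ig_i^l\}$. $(\mathbf{W},\mathbf{w},\mathcal{F})$ is a fusion frame system for $\mathcal{H}$ if $(\mathbf{W},\mathbf{w})$ is a fusion frame for $\mathcal{H}$ and each $\mathcal{F}_i$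 is a frame for $W_i$. Let $C_{\mathcal{F}}:\bigoplus_{i}\mathbb{F}^{|L_i|}\to\mathcal{W}$, $C_{\mathcal{F}}((x_i^l)_{l\in L_i})_{i}=(\sum_{l\in L_i}x_i^lf_i^l)_{i}$, with adjoint $C_{\mathcal{F}}^*(g_i)_i=((\langle g_i,f_i^l\rangle)_{l\in L_i})_i$; similarly $C_{\mathcal{G}}$ with values in $\mathcal{V}$. Given fusion frame systems $(\mathbf{W},\mathbf{w},\mathcal{F})$ and $(\mathbf{V},\mathbf{v},\mathcal{G})$ for $\mathcal{H}$ with $|\mathcal{F}_i|=|\mathcal{G}_i|$ for all $i$, $(\mathbf{V},\mathbf{v},\mathcal{G})$ is a dual fusion frame system of $(\mathbf{W},\mathbf{w},\mathcal{F})$ if $(\mathbf{V},\mathbf{v})$ is a $C_{\mathcal{G}}C_{\mathcal{F}}^*$-dual fusion frame of $(\mathbf{W},\mathbf{w})$. *)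

theory Defs
  imports "HOL-Analysis.Analysis"
begin

(* The scalar field: an R-algebra which is R-isomorphic to R (with trivial conjugation) or
   to C (with complex conjugation). Nothing else is an instance. *)
class real_or_complex = real_field +
  fixes kcnj :: "'a \<Rightarrow> 'a"
  assumes real_or_complex:
    "(\<exists>\<phi> :: 'a \<Rightarrow> real. (\<forall>x y. \<phi> (x + y) = \<phi> x + \<phi> y)
        \<and> (\<forall>r x. \<phi> (r *\<^sub>R x) = r *\<^sub>R \<phi> x) \<and> bij \<phi> \<and> (\<forall>x y. \<phi> (x * y) = \<phi> x * \<phi> y)
        \<and> (\<forall>x. \<phi> (kcnj x) = \<phi> x))
     \<or> (\<exists>\<phi> :: 'a \<Rightarrow> complex. (\<forall>x y. \<phi> (x + y) = \<phi> x + \<phi> y)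
        \<and> (\<forall>r x. \<phi> (r *\<^sub>R x) = r *\<^sub>R \<phi> x) \<and> bij \<phi> \<and> (\<forall>x y. \<phi> (x * y) = \<phi> x * \<phi> y)
        \<and> (\<forall>x. \<phi> (kcnj x) = cnj (\<phi> x)))"

instantiation real :: real_or_complex
begin
definition kcnj_real :: "real \<Rightarrow> real" where "kcnj_real x = x"
instance
proof
  show "(\<exists>\<phi> :: real \<Rightarrow> real. (\<forall>x y. \<phi> (x + y) = \<phi> x + \<phi> y)
        \<and> (\<forall>r x. \<phi> (r *\<^sub>R x) = r *\<^sub>R \<phi> x) \<and> bij \<phi> \<and> (\<forall>x y. \<phi> (x * y) = \<phi> x * \<phi> y)
        \<and> (\<forall>x. \<phi> (kcnj x) = \<phi> x))
     \<or> (\<exists>\<phi> :: real \<Rightarrow> complex. (\<forall>x y. \<phi> (x + y) = \<phi> x + \<phi> y)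
        \<and> (\<forall>r x. \<phi> (r *\<^sub>R x) = r *\<^sub>R \<phi> x) \<and> bij \<phi> \<and> (\<forall>x y. \<phi> (x * y) = \<phi> x * \<phi> y)
        \<and> (\<forall>x. \<phi> (kcnj x) = cnj (\<phi> x)))"
    by (intro disjI1 exI[of _ id]) (simp add: kcnj_real_def)
qed
end

instantiation complex :: real_or_complex
begin
definition kcnj_complex :: "complex \<Rightarrow> complex" where "kcnj_complex = cnj"
instance
proof
  show "(\<exists>\<phi> :: complex \<Rightarrow> real. (\<forall>x y. \<phi> (x + y) = \<phi> x + \<phi> y)
        \<and> (\<forall>r x. \<phi> (r *\<^sub>R x) = r *\<^sub>R \<phi> x) \<and> bij \<phi> \<and> (\<forall>x y. \<phi> (x * y) = \<phi> x * \<phi> y)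
        \<and> (\<forall>x. \<phi> (kcnj x) = \<phi> x))
     \<or> (\<exists>\<phi> :: complex \<Rightarrow> complex. (\<forall>x y. \<phi> (x + y) = \<phi> x + \<phi> y)
        \<and> (\<forall>r x. \<phi> (r *\<^sub>R x) = r *\<^sub>R \<phi> x) \<and> bij \<phi> \<and> (\<forall>x y. \<phi> (x * y) = \<phi> x * \<phi> y)
        \<and> (\<forall>x. \<phi> (kcnj x) = cnj (\<phi> x)))"
    by (intro disjI2 exI[of _ id]) (simp add: kcnj_complex_def)
qed
end

lemma kcnj_add: "kcnj (x + y) = kcnj x + kcnj (y :: 'a :: real_or_complex)"
  using real_or_complex[where 'a = 'a]
proof (elim disjE exE conjE)
  fix \<phi> :: "'a \<Rightarrow> real"
  assume "\<forall>x y. \<phi> (x + y) = \<phi> x + \<phi> y" "bij \<phi>" "\<forall>x. \<phi> (kcnj x) = \<phi> x"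
  then show ?thesis by (metis bij_pointE)
next
  fix \<phi> :: "'a \<Rightarrow> complex"
  assume "\<forall>x y. \<phi> (x + y) = \<phi> x + \<phi> y" "bij \<phi>" "\<forall>x. \<phi> (kcnj x) = cnj (\<phi> x)"
  then show ?thesis by (metis bij_pointE complex_cnj_add)
qed

lemma kcnj_mult: "kcnj (x * y) = kcnj x * kcnj (y :: 'a :: real_or_complex)"
  using real_or_complex[where 'a = 'a]
proof (elim disjE exE conjE)
  fix \<phi> :: "'a \<Rightarrow> real"
  assume "\<forall>x y. \<phi> (x * y) = \<phi> x * \<phi> y" "bij \<phi>" "\<forall>x. \<phi> (kcnj x) = \<phi> x"
  then show ?thesis by (metis bij_pointE)
next
  fix \<phi> :: "'a \<Rightarrow> complex"
  assume "\<forall>x y. \<phi> (x * y) = \<phi> x * \<phi> y" "bij \<phi>" "\<forall>x. \<phi> (kcnj x) = cnj (\<phi> x)"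
  then show ?thesis by (metis bij_pointE complex_cnj_mult)
qed

lemma kcnj_0 [simp]: "kcnj 0 = (0 :: 'a :: real_or_complex)"
  using kcnj_add[of 0 "0 :: 'a"] by simp

lemma kcnj_minus: "kcnj (- x) = - kcnj (x :: 'a :: real_or_complex)"
  using kcnj_add[of x "- x"] by (simp add: eq_neg_iff_add_eq_0 add.commute)

lemma kcnj_of_real [simp]: "kcnj (of_real r) = (of_real r :: 'a :: real_or_complex)"
  using real_or_complex[where 'a = 'a]
proof (elim disjE exE conjE)
  fix \<phi> :: "'a \<Rightarrow> real"
  assume "bij \<phi>" "\<forall>x. \<phi> (kcnj x) = \<phi> x"
  then show ?thesis by (metis bij_pointE)
next
  fix \<phi> :: "'a \<Rightarrow> complex"
  assume \<phi>: "\<forall>r x. \<phi> (r *\<^sub>R x) = r *\<^sub>R \<phi> x" "bij \<phi>" "\<forall>x y. \<phi> (x * y) = \<phi> x * \<phi> y" "\<forall>x. \<phi> (kcnj x) = cnj (\<phi> x)"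
  have "\<phi> 1 = 1" by (metis \<phi>(2,3) bij_pointE mult_cancel_right2 mult_1 one_neq_zero mult.right_neutral)
  then have "\<phi> (of_real r) = of_real r"
    using \<phi>(1) by (simp add: of_real_def)
  then show ?thesis using \<phi>(2,4) by (metis bij_pointE complex_cnj_complex_of_real)
qed

locale fd_hilbert = vector_space scale
  for scale :: "'f :: real_or_complex \<Rightarrow> 'h :: ab_group_add \<Rightarrow> 'h" +
  fixes ip :: "'h \<Rightarrow> 'h \<Rightarrow> 'f"
  assumes ip_add_left: "ip (x + y) z = ip x z + ip y z"
    and ip_scale_left: "ip (scale c x) y = c * ip x y"
    and ip_commute: "ip x y = kcnj (ip y x)"
    and ip_pos: "x \<noteq> 0 \<Longrightarrow> \<exists>r > 0. ip x x = of_real r"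
    and finite_dim: "\<exists>B. finite B \<and> span B = UNIV"
begin

definition frame :: "'i set \<Rightarrow> ('i \<Rightarrow> 'h) \<Rightarrow> 'h set \<Rightarrow> bool" where
  "frame L f K \<longleftrightarrow> finite L \<and> (\<forall>l\<in>L. f l \<in> K) \<and> span (f ` L) = K"

definition dual_frames :: "'i set \<Rightarrow> ('i \<Rightarrow> 'h) \<Rightarrow> ('i \<Rightarrow> 'h) \<Rightarrow> 'h set \<Rightarrow> bool" where
  "dual_frames L f g K \<longleftrightarrow> frame L f K \<and> frame L g K \<and>
     (\<forall>x\<in>K. x = (\<Sum>l\<in>L. scale (ip x (f l)) (g l)))"

definition orth_proj :: "'h set \<Rightarrow> 'h \<Rightarrow> 'h" where
  "orth_proj W x = (THE p. p \<in> W \<and> (\<forall>y\<in>W. ip (x - p) y = 0))"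

definition bessel_fusion_seq :: "nat \<Rightarrow> (nat \<Rightarrow> 'h set) \<Rightarrow> (nat \<Rightarrow> real) \<Rightarrow> bool" where
  "bessel_fusion_seq m W w \<longleftrightarrow> (\<forall>i\<in>{1..m}. subspace (W i) \<and> w i > 0)"

definition fusion_frame :: "nat \<Rightarrow> (nat \<Rightarrow> 'h set) \<Rightarrow> (nat \<Rightarrow> real) \<Rightarrow> bool" where
  "fusion_frame m W w \<longleftrightarrow> bessel_fusion_seq m W w \<and> span (\<Union>i\<in>{1..m}. W i) = UNIV"

(* The external direct sum of W 1, ..., W m: families vanishing outside {1..m}. *)
definition dsum :: "nat \<Rightarrow> (nat \<Rightarrow> 'h set) \<Rightarrow> (nat \<Rightarrow> 'h) set" where
  "dsum m W = {x. (\<forall>i\<in>{1..m}. x i \<in> W i) \<and> (\<forall>i. i \<notin> {1..m} \<longrightarrow> x i = 0)}"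

definition dsum_ip :: "nat \<Rightarrow> (nat \<Rightarrow> 'h) \<Rightarrow> (nat \<Rightarrow> 'h) \<Rightarrow> 'f" where
  "dsum_ip m x y = (\<Sum>i\<in>{1..m}. ip (x i) (y i))"

definition dsum_linear ::
    "nat \<Rightarrow> (nat \<Rightarrow> 'h set) \<Rightarrow> (nat \<Rightarrow> 'h set) \<Rightarrow> ((nat \<Rightarrow> 'h) \<Rightarrow> nat \<Rightarrow> 'h) \<Rightarrow> bool" where
  "dsum_linear m W V Q \<longleftrightarrow>
     (\<forall>x\<in>dsum m W. Q x \<in> dsum m V) \<and>
     (\<forall>x\<in>dsum m W. \<forall>y\<in>dsum m W. Q (\<lambda>i. x i + y i) = (\<lambda>i. Q x i + Q y i)) \<and>
     (\<forall>c. \<forall>x\<in>dsum m W. Q (\<lambda>i. scale c (x i)) = (\<lambda>i. scale c (Q x i)))"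

(* T_{W,w}; the subspaces W only enter through its domain dsum m W. *)
definition fusion_synthesis :: "nat \<Rightarrow> (nat \<Rightarrow> real) \<Rightarrow> (nat \<Rightarrow> 'h) \<Rightarrow> 'h" where
  "fusion_synthesis m w x = (\<Sum>i\<in>{1..m}. scale (of_real (w i)) (x i))"

(* The adjoint of T_{W,w}, see fusion_analysis_adjoint. *)
definition fusion_analysis ::
    "nat \<Rightarrow> (nat \<Rightarrow> 'h set) \<Rightarrow> (nat \<Rightarrow> real) \<Rightarrow> 'h \<Rightarrow> nat \<Rightarrow> 'h" where
  "fusion_analysis m W w x =
     (\<lambda>i. if i \<in> {1..m} then scale (of_real (w i)) (orth_proj (W i) x) else 0)"

definition dual_fusion_frame ::
    "nat \<Rightarrow> ((nat \<Rightarrow> 'h) \<Rightarrow> nat \<Rightarrow> 'h) \<Rightarrow> (nat \<Rightarrow> 'h set) \<Rightarrow> (nat \<Rightarrow> real)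
       \<Rightarrow> (nat \<Rightarrow> 'h set) \<Rightarrow> (nat \<Rightarrow> real) \<Rightarrow> bool" where
  "dual_fusion_frame m Q V v W w \<longleftrightarrow>
     fusion_frame m W w \<and> fusion_frame m V v \<and> dsum_linear m W V Q \<and>
     (\<forall>x. fusion_synthesis m v (Q (fusion_analysis m W w x)) = x)"

definition fusion_frame_system ::
    "nat \<Rightarrow> (nat \<Rightarrow> 'h set) \<Rightarrow> (nat \<Rightarrow> real) \<Rightarrow> (nat \<Rightarrow> 'l set) \<Rightarrow> (nat \<Rightarrow> 'l \<Rightarrow> 'h) \<Rightarrow> bool" where
  "fusion_frame_system m W w L F \<longleftrightarrow>
     fusion_frame m W w \<and> (\<forall>i\<in>{1..m}. frame (L i) (F i) (W i))"

(* C_F on families (x_i^l), l in L i, i in {1..m} *)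
definition local_synthesis ::
    "nat \<Rightarrow> (nat \<Rightarrow> 'l set) \<Rightarrow> (nat \<Rightarrow> 'l \<Rightarrow> 'h) \<Rightarrow> (nat \<Rightarrow> 'l \<Rightarrow> 'f) \<Rightarrow> nat \<Rightarrow> 'h" where
  "local_synthesis m L F x =
     (\<lambda>i. if i \<in> {1..m} then (\<Sum>l\<in>L i. scale (x i l) (F i l)) else 0)"

(* The adjoint of C_F, see local_analysis_adjoint. *)
definition local_analysis ::
    "nat \<Rightarrow> (nat \<Rightarrow> 'l set) \<Rightarrow> (nat \<Rightarrow> 'l \<Rightarrow> 'h) \<Rightarrow> (nat \<Rightarrow> 'h) \<Rightarrow> nat \<Rightarrow> 'l \<Rightarrow> 'f" where
  "local_analysis m L F g = (\<lambda>i l. if i \<in> {1..m} \<and> l \<in> L i then ip (g i) (F i l) else 0)"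

(* (V,v,G) is a dual fusion frame system of (W,w,F); sharing the index sets L i
   renders |F_i| = |G_i|. *)
definition dual_fusion_frame_system ::
    "nat \<Rightarrow> (nat \<Rightarrow> 'l set) \<Rightarrow> (nat \<Rightarrow> 'h set) \<Rightarrow> (nat \<Rightarrow> real) \<Rightarrow> (nat \<Rightarrow> 'l \<Rightarrow> 'h)
       \<Rightarrow> (nat \<Rightarrow> 'h set) \<Rightarrow> (nat \<Rightarrow> real) \<Rightarrow> (nat \<Rightarrow> 'l \<Rightarrow> 'h) \<Rightarrow> bool" where
  "dual_fusion_frame_system m L V v G W w F \<longleftrightarrow>
     fusion_frame_system m W w L F \<and> fusion_frame_system m V v L G \<and>
     dual_fusion_frame m (local_synthesis m L G \<circ> local_analysis m L F) V v W w"

lemma ip_zero_left [simp]: "ip 0 y = 0"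
  using ip_add_left[of 0 0 y] by simp

lemma ip_zero_right [simp]: "ip x 0 = 0"
  using ip_commute[of x 0] by simp

lemma ip_add_right: "ip x (y + z) = ip x y + ip x z"
  by (metis ip_commute ip_add_left kcnj_add)

lemma ip_scale_right: "ip x (scale c y) = kcnj c * ip x y"
  by (metis ip_commute ip_scale_left kcnj_mult)

lemma ip_diff_left: "ip (x - y) z = ip x z - ip y z"
  using ip_add_left[of "x - y" y z] by simp

lemma ip_sum_left: "ip (sum f A) y = (\<Sum>a\<in>A. ip (f a) y)"
  by (induction A rule: infinite_finite_induct) (simp_all add: ip_add_left)

lemma ip_self_eq_0: "ip x x = 0 \<longleftrightarrow> x = 0"
  by (metis ip_pos ip_zero_left of_real_eq_0_iff order_less_irrefl)

lemma orth_proj_ex_span: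
  assumes "finite B"
  shows "\<exists>p\<in>span B. \<forall>y\<in>span B. ip (x - p) y = 0"
  using assms
proof (induction B arbitrary: x rule: finite_induct)
  case empty
  then show ?case by simp
next
  case (insert b B)
  obtain q where q: "q \<in> span B" "\<forall>y\<in>span B. ip (b - q) y = 0" using insert.IH by blast
  obtain p where p: "p \<in> span B" "\<forall>y\<in>span B. ip (x - p) y = 0" using insert.IH by blast
  define e where "e = b - q"
  define p' where "p' = p + scale (ip (x - p) e / ip e e) e"
  have e: "ip e y = 0" if "y \<in> span B" for y using q that by (simp add: e_def)
  have sub: "span B \<subseteq> span (insert b B)" by (rule span_mono) auto
  have "e \<in> span (insert b B)"
    unfolding e_def using q(1) sub by (intro span_diff) (auto intro: span_base)
  then have p'in: "p' \<in> span (insert b B)"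
    unfolding p'_def using p(1) sub by (intro span_add span_scale) auto
  have orth: "ip (x - p') y = 0" if "y \<in> span B" for y
    using p(2) e[OF that] that
    by (simp add: p'_def ip_diff_left ip_add_left ip_scale_left)
  have orthe: "ip (x - p') e = 0"
    by (cases "e = 0")
      (simp_all add: p'_def ip_diff_left ip_add_left ip_scale_left ip_self_eq_0)
  have "ip (x - p') y = 0" if y: "y \<in> span (insert b B)" for y
  proof -
    obtain k where k: "y - scale k b \<in> span B" using y unfolding span_insert by blast
    have "y = (y - scale k b) + scale k (e + q)" by (simp add: e_def)
    then show ?thesis
      using orth[OF k] orth[OF q(1)] orthe by (metis ip_add_right ip_scale_right add_0 mult_zero_right)
  qed
  then show ?case using p'in by blast
qed

lemma subspace_finite_span:
  assumes "subspace W"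
  shows "\<exists>B. finite B \<and> span B = W"
proof -
  obtain A where A: "finite A" "span A = UNIV" using finite_dim by blast
  obtain B where B: "B \<subseteq> W" "independent B" "W \<subseteq> span B"
    using maximal_independent_subset by blast
  have "finite B" using independent_span_bound[of A B] A B by auto
  then show ?thesis using B assms span_minimal by blast
qed

lemma orth_proj_ex1:
  assumes "subspace W"
  shows "\<exists>!p. p \<in> W \<and> (\<forall>y\<in>W. ip (x - p) y = 0)"
proof -
  obtain p where p: "p \<in> W" "\<forall>y\<in>W. ip (x - p) y = 0"
    using subspace_finite_span[OF assms] orth_proj_ex_span by blast
  have "p' = p" if "p' \<in> W" "\<forall>y\<in>W. ip (x - p') y = 0" for p'
  proof -
    have "p - p' \<in> W" using p that assms subspace_diff by blast
    then have "ip (x - p') (p - p') - ip (x - p) (p - p') = 0" using p that by simp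
    then have "ip (p - p') (p - p') = 0" by (simp add: ip_diff_left)
    then show ?thesis by (simp add: ip_self_eq_0)
  qed
  then show ?thesis using p by blast
qed

lemma orth_proj:
  assumes "subspace W"
  shows "orth_proj W x \<in> W" "\<And>y. y \<in> W \<Longrightarrow> ip (x - orth_proj W x) y = 0"
  using theI'[OF orth_proj_ex1[OF assms]] unfolding orth_proj_def by blast+

lemma fusion_analysis_adjoint:
  assumes "bessel_fusion_seq m W w"
  shows "fusion_analysis m W w y \<in> dsum m W"
    and "x \<in> dsum m W \<Longrightarrow> ip (fusion_synthesis m w x) y = dsum_ip m x (fusion_analysis m W w y)"
proof -
  have W: "subspace (W i)" if "i \<in> {1..m}" for i
    using assms that by (simp add: bessel_fusion_seq_def)
  show "fusion_analysis m W w y \<in> dsum m W"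
    using W orth_proj(1) by (auto simp: dsum_def fusion_analysis_def intro!: subspace_scale)
  assume x: "x \<in> dsum m W"
  have "ip (x i) y = ip (x i) (orth_proj (W i) y)" if "i \<in> {1..m}" for i
  proof -
    have "ip (y - orth_proj (W i) y) (x i) = 0"
      using orth_proj(2)[OF W[OF that]] x that by (auto simp: dsum_def)
    then show ?thesis by (metis ip_diff_left ip_commute eq_iff_diff_eq_0)
  qed
  then show "ip (fusion_synthesis m w x) y = dsum_ip m x (fusion_analysis m W w y)"
    by (simp add: fusion_synthesis_def dsum_ip_def fusion_analysis_def ip_sum_left
        ip_scale_left ip_scale_right)
qed

lemma local_analysis_adjoint:
  "dsum_ip m (local_synthesis m L F x) g =
     (\<Sum>i\<in>{1..m}. \<Sum>l\<in>L i. x i l * kcnj (local_analysis m L F g i l))"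
  unfolding dsum_ip_def local_synthesis_def local_analysis_def
  by (intro sum.cong refl) (simp add: ip_sum_left ip_scale_left ip_commute[symmetric])

end

lemma fd_hilbert_real:
  "fd_hilbert ((*\<^sub>R) :: real \<Rightarrow> 'a :: euclidean_space \<Rightarrow> 'a) inner"
proof unfold_locales
  show "\<exists>r>0. inner x x = of_real r" if "x \<noteq> 0" for x :: 'a
    using that by (intro exI[of _ "inner x x"]) auto
  show "\<exists>B :: 'a set. finite B \<and> module.span (*\<^sub>R) B = UNIV"
    using span_Basis by (intro exI[of _ Basis]) (simp add: span_raw_def)
qed (auto simp: inner_add_left kcnj_real_def inner_commute algebra_simps)

lemma fd_hilbert_complex:
  "fd_hilbert ((*s) :: complex \<Rightarrow> complex ^ 'n \<Rightarrow> complex ^ 'n) (\<lambda>x y. \<Sum>i\<in>UNIV. x $ i * cnj (y $ i))"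
proof unfold_locales
  show "\<exists>r>0. (\<Sum>i\<in>UNIV. x $ i * cnj (x $ i)) = of_real r"
    if x: "x \<noteq> 0" for x :: "complex ^ 'n"
  proof (intro exI conjI)
    obtain j where "x $ j \<noteq> 0" using x unfolding vec_eq_iff by auto
    then show "0 < (\<Sum>i\<in>UNIV. (cmod (x $ i))\<^sup>2)"
      by (intro sum_pos2[of _ j]) auto
  qed (simp add: complex_norm_square[symmetric])
  show "\<exists>B :: (complex ^ 'n) set. finite B \<and> vec.span B = UNIV"
    by (intro exI[of _ cart_basis]) (simp add: vec.finite_Basis)
qed (auto simp: kcnj_complex_def algebra_simps sum.distrib sum_distrib_left)

end

theory Submission
  imports Defs
begin

text \<open>
  Rescaling the vectors of each local frame by a nonzero weight does not change their span, so
  the weighted global families are frames exactly when the weighted subspaces are fusion frames.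
  The duality equations agree because the frame operator mixing the two global families is
  the composition of fusion synthesis, local synthesis, local analysis and fusion analysis:
  each \<open>f\<^sub>i\<^sup>l\<close> lies in \<open>W\<^sub>i\<close>, so projecting onto \<open>W\<^sub>i\<close> does not change the inner
  product with it.
\<close>

context fd_hilbert
begin

text \<open>The residual \<open>x - orth_proj W x\<close> is orthogonal to \<open>W\<close>.\<close>

lemma ip_orth_proj:
  assumes "subspace W" and "y \<in> W"
  shows "ip (orth_proj W x) y = ip x y"
  using orth_proj(2)[OF assms, of x] by (simp add: ip_diff_left)

text \<open>Each generating set lies in the span of the other: a scaled vector stays in its
  \<open>W i\<close>, and multiplying by \<open>inverse (a i)\<close> recovers \<open>f i l\<close>,
  hence all of \<open>W i\<close>.\<close>

lemma span_scaled_family: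
  assumes "\<And>i. i \<in> I \<Longrightarrow> a i \<noteq> 0"
    and "\<And>i. i \<in> I \<Longrightarrow> span (f i ` L i) = W i"
  shows "span ((\<lambda>(i, l). scale (a i) (f i l)) ` Sigma I L) = span (\<Union>i\<in>I. W i)"
    (is "span ?S = span ?U")
proof -
  have "scale (a i) (f i l) \<in> span ?U" if "i \<in> I" "l \<in> L i" for i l
  proof -
    have "f i l \<in> W i" using assms(2)[OF that(1)] that(2) by (metis imageI span_base)
    then show ?thesis using that(1) by (intro span_scale span_base) blast
  qed
  moreover have "W i \<subseteq> span ?S" if i: "i \<in> I" for i
  proof -
    have "f i l \<in> span ?S" if l: "l \<in> L i" for l
    proof -
      have "scale (a i) (f i l) \<in> ?S" using i l by force
      then have "scale (inverse (a i)) (scale (a i) (f i l)) \<in> span ?S"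
        by (intro span_scale span_base)
      then show ?thesis using assms(1)[OF i] by simp
    qed
    then have "span (f i ` L i) \<subseteq> span ?S" by (intro span_minimal) auto
    then show ?thesis using assms(2)[OF i] by simp
  qed
  ultimately show ?thesis unfolding span_eq by auto
qed

lemma frame_weighted_iff_fusion_frame:
  assumes "bessel_fusion_seq m W w"
    and "\<And>i. i \<in> {1..m} \<Longrightarrow> frame (L i) (F i) (W i)"
  shows "frame (SIGMA i:{1..m}. L i) (\<lambda>(i, l). scale (of_real (w i)) (F i l)) UNIV
     \<longleftrightarrow> fusion_frame m W w"
proof -
  \<comment> \<open>Positive real weights remain nonzero in the scalar field, as the rescaling of
    spans requires.\<close>
  have "of_real (w i) \<noteq> (0 :: 'f)" if "i \<in> {1..m}" for i
    using assms(1) that by (force simp: bessel_fusion_seq_def)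
  then have "span ((\<lambda>(i, l). scale (of_real (w i)) (F i l)) ` (SIGMA i:{1..m}. L i))
      = span (\<Union>i\<in>{1..m}. W i)"
    using assms(2) by (intro span_scaled_family) (simp_all add: frame_def)
  moreover have "finite (SIGMA i:{1..m}. L i)"
    using assms(2) by (intro finite_SigmaI) (auto simp: frame_def)
  ultimately show ?thesis
    using assms(1) by (simp add: frame_def fusion_frame_def)
qed

text \<open>Supplies the linearity demanded of \<open>Q\<close> in \<open>dual_fusion_frame\<close>.
  The values land in \<open>V i\<close> because they are combinations of vectors
  \<open>G i l\<close> spanning it, and \<open>ip\<close> is linear in its first argument.\<close>

lemma dsum_linear_local_synthesis_analysis:
  assumes "\<And>i. i \<in> {1..m} \<Longrightarrow> frame (L i) (G i) (V i)"
  shows "dsum_linear m W V (local_synthesis m L G \<circ> local_analysis m L F)"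
proof -
  have "(\<Sum>l\<in>L i. scale (c l) (G i l)) \<in> V i" if "i \<in> {1..m}" for i c
  proof -
    have "(\<Sum>l\<in>L i. scale (c l) (G i l)) \<in> span (G i ` L i)"
      by (intro span_sum span_scale span_base) auto
    then show ?thesis using assms[OF that] by (simp add: frame_def)
  qed
  then show ?thesis
    by (auto simp: dsum_linear_def dsum_def local_synthesis_def local_analysis_def fun_eq_iff
        ip_add_left ip_scale_left scale_left_distrib sum.distrib scale_sum_right)
qed

lemma fusion_synthesis_local_analysis:
  assumes "bessel_fusion_seq m W w"
    and "\<And>i. i \<in> {1..m} \<Longrightarrow> frame (L i) (F i) (W i)"
  shows "fusion_synthesis m v
      ((local_synthesis m L G \<circ> local_analysis m L F) (fusion_analysis m W w x))
    = (\<Sum>p\<in>(SIGMA i:{1..m}. L i). scale (ip x ((\<lambda>(i, l). scale (of_real (w i)) (F i l)) p))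
         ((\<lambda>(i, l). scale (of_real (v i)) (G i l)) p))"
proof -
  \<comment> \<open>The projection inside fusion analysis disappears here, since
    \<open>F i l\<close> lies in \<open>W i\<close>.\<close>
  have ip: "ip (orth_proj (W i) x) (F i l) = ip x (F i l)" if "i \<in> {1..m}" "l \<in> L i" for i l
    using assms that by (intro ip_orth_proj) (auto simp: bessel_fusion_seq_def frame_def)
  have "fusion_synthesis m v
      ((local_synthesis m L G \<circ> local_analysis m L F) (fusion_analysis m W w x))
    = (\<Sum>i\<in>{1..m}. \<Sum>l\<in>L i.
         scale (ip x (scale (of_real (w i)) (F i l))) (scale (of_real (v i)) (G i l)))"
    unfolding fusion_synthesis_def
    \<comment> \<open>The weight \<open>w i\<close> is real, so it enters the second slot of
      \<open>ip\<close> without being changed by \<open>kcnj\<close>; \<open>v i\<close> is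
      distributed over the inner sum.\<close>
    by (intro sum.cong refl)
      (auto simp: local_synthesis_def local_analysis_def fusion_analysis_def scale_sum_right
        ip_scale_left ip_scale_right ip mult.commute intro!: sum.cong)
  also have "\<dots> = (\<Sum>(i, l)\<in>(SIGMA i:{1..m}. L i).
         scale (ip x (scale (of_real (w i)) (F i l))) (scale (of_real (v i)) (G i l)))"
    using assms(2) by (intro sum.Sigma) (auto simp: frame_def)
  finally show ?thesis by (simp add: case_prod_unfold)
qed

end

theorem theorem4p3:
  fixes scale :: "'f :: real_or_complex \<Rightarrow> 'h :: ab_group_add \<Rightarrow> 'h"
    and ip :: "'h \<Rightarrow> 'h \<Rightarrow> 'f"
    and m :: nat
    and W V :: "nat \<Rightarrow> 'h set"
    and w v :: "nat \<Rightarrow> real"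
    and L :: "nat \<Rightarrow> 'l set"
    and F G :: "nat \<Rightarrow> 'l \<Rightarrow> 'h"
  assumes "fd_hilbert scale ip"
    and "fd_hilbert.bessel_fusion_seq scale m W w"
    and "fd_hilbert.bessel_fusion_seq scale m V v"
    and "\<And>i. i \<in> {1..m} \<Longrightarrow> fd_hilbert.frame scale (L i) (F i) (W i)"
    and "\<And>i. i \<in> {1..m} \<Longrightarrow> fd_hilbert.frame scale (L i) (G i) (V i)"
  shows "fd_hilbert.dual_frames scale ip (SIGMA i:{1..m}. L i)
           (\<lambda>(i, l). scale (of_real (w i)) (F i l))
           (\<lambda>(i, l). scale (of_real (v i)) (G i l)) UNIV
     \<longleftrightarrow> fd_hilbert.dual_fusion_frame_system scale ip m L V v G W w F"
proof -
  interpret fd_hilbert scale ip by (fact assms(1))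
  have W_iff: "frame (SIGMA i:{1..m}. L i) (\<lambda>(i, l). scale (of_real (w i)) (F i l)) UNIV
      \<longleftrightarrow> fusion_frame m W w"
    using assms(2,4) by (rule frame_weighted_iff_fusion_frame)
  have V_iff: "frame (SIGMA i:{1..m}. L i) (\<lambda>(i, l). scale (of_real (v i)) (G i l)) UNIV
      \<longleftrightarrow> fusion_frame m V v"
    using assms(3,5) by (rule frame_weighted_iff_fusion_frame)
  have mixed: "fusion_synthesis m v
      ((local_synthesis m L G \<circ> local_analysis m L F) (fusion_analysis m W w x))
    = (\<Sum>p\<in>(SIGMA i:{1..m}. L i). scale (ip x ((\<lambda>(i, l). scale (of_real (w i)) (F i l)) p))
         ((\<lambda>(i, l). scale (of_real (v i)) (G i l)) p))" for x
    using assms(2,4) by (rule fusion_synthesis_local_analysis)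
  \<comment> \<open>With linearity and the local frames established, a dual system amounts to two
    fusion frames and the reconstruction identity.\<close>
  have "dsum_linear m W V (local_synthesis m L G \<circ> local_analysis m L F)"
    using assms(5) by (rule dsum_linear_local_synthesis_analysis)
  then have "dual_fusion_frame_system m L V v G W w F \<longleftrightarrow>
      fusion_frame m W w \<and> fusion_frame m V v \<and>
      (\<forall>x. fusion_synthesis m v
        ((local_synthesis m L G \<circ> local_analysis m L F) (fusion_analysis m W w x)) = x)"
    using assms(4,5)
    unfolding dual_fusion_frame_system_def dual_fusion_frame_def fusion_frame_system_def by blast
  also have "\<dots> \<longleftrightarrow> dual_frames (SIGMA i:{1..m}. L i)
      (\<lambda>(i, l). scale (of_real (w i)) (F i l)) (\<lambda>(i, l). scale (of_real (v i)) (G i l)) UNIV"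
    \<comment> \<open>\<open>eq_commute\<close> reconciles the opposite orientations of the two
      reconstruction identities.\<close>
    by (simp only: dual_frames_def W_iff V_iff mixed ball_UNIV eq_commute)
  finally show ?thesis by (rule sym)
qed

end
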